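(* Let $E$ be a finite set with $\#E\geq 3$ elements, $N\geq 2$, $T>0$, and let $f:[0,1]\to\mathbb{R}_+$. Consider the particle system on $E^N$ in which, when the configuration is $\bar x=(x_1,\ldots,x_N)$, each particle $i\in\{1,\ldots,N\}$ jumps from $x_i$ to $y\in E$ with rate $$\frac{T}{\# E}+f\left(\frac{\sum_{j=1}^N \mathbf{1}_{x_j=y}}{N}\right).$$ Assume that $f$ is a Lipschitz function and set $\|f\|_{Lip}=\sup_{u\neq v\in[0,1]} |f(u)-f(v)|/|u-v|$. Then the coarse Ricci curvature $\sigma$ of this particle system satisfies $$\sigma\geq T-2\,\|f\|_{Lip}+\inf_\mu \sum_{x\in E} f(\mu(x)),$$ where the infimum is taken over the probability measures $\mu$ on $E$. Moreover, if $f$ is monotone, then $$\sigma\geq T-\|f\|_{Lip}+\inf_\mu \sum_{x\in E} f(\mu(x)).$$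
   Context: $E$ is endowed with the distance $d(x,y)=\mathbf{1}_{x\neq y}$, and $E^N$ with $d(\bar x,\bar y)=\frac1N\sum_{i=1}^N d(x_i,y_i)$. The process is the continuous-time Markov process on $E^N$ with generator $\mathcal{L}g(\bar x)=\sum_{i=1}^N\sum_{y\in E}\bigl(g(x_1,\ldots,x_{i-1},y,x_{i+1},\ldots,x_N)-g(\bar x)\bigr)\bigl(\frac{T}{\#E}+f(\frac1N\sum_{j=1}^N\mathbf{1}_{x_j=y})\bigr)$. The coarse Ricci curvature of a Markov process $\bar X$ on $E^N$ is the largest $\sigma\in[-\infty,+\infty]$ such that, for all $t\geq0$ and all $\bar x,\bar y\in E^N$, $\mathcal{W}_d\bigl(\mathbb{P}(\bar X_t\in\cdot\mid\bar X_0=\bar x),\mathbb{P}(\bar X_t\in\cdot\mid\bar X_0=\bar y)\bigr)\leq e^{-\sigma t}d(\bar x,\bar y)$, where $\mathcal{W}_d(\mu,\nu)=\inf_\pi\int d\,d\pi$ is the Wasserstein distance (infimum over couplings $\pi$ of $\mu$ and $\nu$). *)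

theory Defs
  imports "HOL-Probability.Probability" "HOL-Real_Asymp.Real_Asymp"
begin

section \<open>Continuous-time Markov processes on a finite state space\<close>

definition history ::
  "'w measure \<Rightarrow> (real \<Rightarrow> 'w \<Rightarrow> 's) \<Rightarrow> real \<Rightarrow> 'w set set" where
  "history P X s =
     sigma_sets (space P) {X u -` B \<inter> space P | u B. 0 \<le> u \<and> u \<le> s}"

text \<open>
  A process is given by the family of laws \<open>M x\<close>, where \<open>M x\<close> plays the role of the conditional
  probability given that the process starts at \<open>x\<close>. The last clause is the time-homogeneous Markov
  property with respect to the natural filtration,
  \<open>P\<^sub>x(A, X\<^bsub>s+t\<^esub> = z) = E\<^sub>x[1\<^sub>A p\<^sub>t(X\<^sub>s, z)]\<close> where \<open>p\<^sub>t(y, z) = P\<^sub>y(X\<^sub>t = z)\<close>;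
  the expectation is written as a sum over the finitely many values of \<open>X\<^sub>s\<close>.
\<close>

definition markov_process ::
  "('s::finite \<Rightarrow> 'w measure) \<Rightarrow> (real \<Rightarrow> 'w \<Rightarrow> 's) \<Rightarrow> bool" where
  "markov_process M X \<longleftrightarrow>
     (\<forall>x. prob_space (M x)) \<and>
     (\<forall>x. \<forall>t\<ge>0. X t \<in> M x \<rightarrow>\<^sub>M count_space UNIV) \<and>
     (\<forall>x. AE \<omega> in M x. X 0 \<omega> = x) \<and>
     (\<forall>x. \<forall>s\<ge>0. \<forall>t\<ge>0. \<forall>A\<in>history (M x) X s. \<forall>z.
        measure (M x) {\<omega>\<in>A. X (s + t) \<omega> = z} =
        (\<Sum>y\<in>UNIV. measure (M x) {\<omega>\<in>A. X s \<omega> = y} *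
                   measure (M y) {\<omega>\<in>space (M y). X t \<omega> = z}))"

definition has_generator ::
  "('s::finite \<Rightarrow> 'w measure) \<Rightarrow> (real \<Rightarrow> 'w \<Rightarrow> 's) \<Rightarrow>
   (('s \<Rightarrow> real) \<Rightarrow> 's \<Rightarrow> real) \<Rightarrow> bool" where
  "has_generator M X L \<longleftrightarrow>
     (\<forall>g x. ((\<lambda>t. ((\<integral>\<omega>. g (X t \<omega>) \<partial>M x) - g x) / t) \<longlongrightarrow> L g x) (at_right 0))"


section \<open>Wasserstein distance and coarse Ricci curvature\<close>

definition couplings :: "'a measure \<Rightarrow> 'b measure \<Rightarrow> ('a \<times> 'b) measure set" where
  "couplings \<mu> \<nu> =
     {\<pi>. sets \<pi> = sets (\<mu> \<Otimes>\<^sub>M \<nu>) \<and> distr \<pi> \<mu> fst = \<mu> \<and> distr \<pi> \<nu> snd = \<nu>}"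

definition wasserstein ::
  "('a \<Rightarrow> 'a \<Rightarrow> real) \<Rightarrow> 'a measure \<Rightarrow> 'a measure \<Rightarrow> ennreal" where
  "wasserstein d \<mu> \<nu> = (INF \<pi>\<in>couplings \<mu> \<nu>. \<integral>\<^sup>+ z. ennreal (d (fst z) (snd z)) \<partial>\<pi>)"

definition law_at ::
  "('s \<Rightarrow> 'w measure) \<Rightarrow> (real \<Rightarrow> 'w \<Rightarrow> 's) \<Rightarrow> real \<Rightarrow> 's \<Rightarrow> 's measure" where
  "law_at M X t x = distr (M x) (count_space UNIV) (X t)"

definition exp_ereal :: "ereal \<Rightarrow> ennreal" where
  "exp_ereal a =
     (case a of ereal r \<Rightarrow> ennreal (exp r) | PInfty \<Rightarrow> \<infinity> | MInfty \<Rightarrow> 0)"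

lemma exp_ereal_simps [simp]:
  "exp_ereal (ereal r) = ennreal (exp r)"
  "exp_ereal \<infinity> = \<infinity>"
  "exp_ereal (-\<infinity>) = 0"
  by (simp_all add: exp_ereal_def)

text \<open>
  For infinite \<open>\<sigma>\<close> the conventions of the library apply: \<open>\<infinity> * 0 = 0\<close>, both in the exponent
  (at \<open>t = 0\<close>) and in the product with the distance (at \<open>x = y\<close>).
\<close>

definition curvature_bounds ::
  "('s \<Rightarrow> 'w measure) \<Rightarrow> (real \<Rightarrow> 'w \<Rightarrow> 's) \<Rightarrow> ('s \<Rightarrow> 's \<Rightarrow> real) \<Rightarrow> ereal set" where
  "curvature_bounds M X d =
     {\<sigma>. \<forall>t\<ge>0. \<forall>x y. wasserstein d (law_at M X t x) (law_at M X t y)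
            \<le> exp_ereal (- (\<sigma> * ereal t)) * ennreal (d x y)}"

text \<open>
  The supremum is a maximum as soon as the set is nonempty; see \<open>coarse_ricci_attained\<close> below.
\<close>

definition coarse_ricci ::
  "('s \<Rightarrow> 'w measure) \<Rightarrow> (real \<Rightarrow> 'w \<Rightarrow> 's) \<Rightarrow> ('s \<Rightarrow> 's \<Rightarrow> real) \<Rightarrow> ereal" where
  "coarse_ricci M X d = Sup (curvature_bounds M X d)"

lemma exp_ereal_mono: "a \<le> b \<Longrightarrow> exp_ereal a \<le> exp_ereal b"
  by (cases a; cases b) (auto simp: ennreal_leI)

lemma exp_ereal_attained:
  fixes A :: "ereal set" and t :: real and w D :: ennreal
  assumes "0 \<le> t" "A \<noteq> {}" "D < \<infinity>"
    and le: "\<And>\<sigma>. \<sigma> \<in> A \<Longrightarrow> w \<le> exp_ereal (- (\<sigma> * ereal t)) * D"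
  shows "w \<le> exp_ereal (- (Sup A * ereal t)) * D"
proof (cases "t = 0")
  case True
  obtain \<sigma> where "\<sigma> \<in> A" using assms(2) by blast
  from le[OF this] True show ?thesis by (simp add: zero_ereal_def[symmetric])
next
  case False
  with assms(1) have t: "0 < t" by simp
  have below: "w \<le> ennreal (exp (- (r * t))) * D" if "ereal r < Sup A" for r :: real
  proof -
    from that obtain \<sigma> where s: "\<sigma> \<in> A" "ereal r < \<sigma>" by (auto simp: less_Sup_iff)
    have "ereal r * ereal t \<le> \<sigma> * ereal t"
      using s(2) assms(1) by (intro ereal_mult_right_mono) auto
    then have "exp_ereal (- (\<sigma> * ereal t)) \<le> exp_ereal (- (ereal r * ereal t))"
      by (intro exp_ereal_mono) (simp only: ereal_minus_le_minus)
    also have "\<dots> = ennreal (exp (- (r * t)))" by simp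
    finally show ?thesis
      using le[OF s(1)] by (meson mult_right_mono order_trans zero_le)
  qed
  show ?thesis
  proof (cases "Sup A")
    case (real S)
    have "((\<lambda>e. ennreal (exp (- ((S - e) * t))) * D) \<longlongrightarrow> ennreal (exp (- ((S - 0) * t))) * D)
            (at_right 0)"
      using assms(3)
      by (intro tendsto_mult_ennreal tendsto_ennrealI tendsto_intros) auto
    moreover have "\<forall>\<^sub>F e in at_right 0. w \<le> ennreal (exp (- ((S - e) * t))) * D"
      using below real by (auto simp: eventually_at_right_less eventually_at_filter)
    ultimately have "w \<le> ennreal (exp (- ((S - 0) * t))) * D"
      by (intro tendsto_lowerbound[where F = "at_right 0"]) auto
    then show ?thesis using real by simp
  next
    case PInf
    have "((\<lambda>r. exp (- (r * t))) \<longlongrightarrow> 0) at_top"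
      using t by real_asymp
    then have "((\<lambda>r. ennreal (exp (- (r * t))) * D) \<longlongrightarrow> ennreal 0 * D) at_top"
      using assms(3) by (intro tendsto_mult_ennreal tendsto_ennrealI tendsto_const) auto
    moreover have "\<forall>\<^sub>F r in at_top. w \<le> ennreal (exp (- (r * t))) * D"
      using below PInf by auto
    ultimately have "w \<le> ennreal 0 * D"
      by (intro tendsto_lowerbound[where F = "at_top :: real filter"]) auto
    then show ?thesis by simp
  next
    case MInf
    then have "-\<infinity> \<in> A"
      using assms(2) by (metis Sup_eq_MInfty equals0I singletonD subset_singletonD insertI1)
    from le[OF this] MInf show ?thesis by simp
  qed
qed

lemma coarse_ricci_attained:
  assumes "curvature_bounds M X d \<noteq> {}"
  shows "coarse_ricci M X d \<in> curvature_bounds M X d"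
proof -
  have "wasserstein d (law_at M X t x) (law_at M X t y)
          \<le> exp_ereal (- (Sup (curvature_bounds M X d) * ereal t)) * ennreal (d x y)"
    if "0 \<le> t" for t x y
    using that assms by (intro exp_ereal_attained) (auto simp: curvature_bounds_def)
  then show ?thesis
    by (subst curvature_bounds_def) (auto simp: coarse_ricci_def)
qed


section \<open>The particle system\<close>

definition config_dist :: "'e ^ 'n \<Rightarrow> 'e ^ 'n \<Rightarrow> real" where
  "config_dist x y = (1 / real CARD('n)) * (\<Sum>i\<in>UNIV. of_bool (x $ i \<noteq> y $ i))"

definition empirical :: "'e ^ 'n \<Rightarrow> 'e \<Rightarrow> real" where
  "empirical x y = (\<Sum>j\<in>UNIV. of_bool (x $ j = y)) / real CARD('n)"

definition jump :: "'e ^ 'n \<Rightarrow> 'n \<Rightarrow> 'e \<Rightarrow> 'e ^ 'n" where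
  "jump x i y = (\<chi> j. if j = i then y else x $ j)"

definition particle_generator ::
  "real \<Rightarrow> (real \<Rightarrow> real) \<Rightarrow> ('e ^ 'n \<Rightarrow> real) \<Rightarrow> 'e ^ 'n \<Rightarrow> real" where
  "particle_generator T f g x =
     (\<Sum>i\<in>UNIV. \<Sum>y\<in>UNIV.
        (g (jump x i y) - g x) * (T / real CARD('e) + f (empirical x y)))"

definition lip_norm :: "(real \<Rightarrow> real) \<Rightarrow> real" where
  "lip_norm f =
     (SUP (u, v)\<in>{(u, v). u \<in> {0..1} \<and> v \<in> {0..1} \<and> u \<noteq> v}. \<bar>f u - f v\<bar> / \<bar>u - v\<bar>)"

end

theory Submission
  imports Defs
begin

text \<open>
  By Kantorovich duality it suffices that the semigroup shrinks Lipschitz constants at exponential rate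
  \<open>\<sigma>\<close>. By the semigroup property this only has to be checked for small times and all rates
  \<open>s < \<sigma>\<close>, where the semigroup is \<open>I + h * L + o(h)\<close>. For the particle system, let \<open>d\<close> be the distance
  of \<open>x\<close> and \<open>y\<close>, \<open>R\<close> the larger of their total jump rates per particle and \<open>m\<close> the total of the minima of
  their jump rates per particle. Coupling the two copies of every particle maximally, a differing
  coordinate merges at rate \<open>m\<close> at least and an equal one splits at rate \<open>R - m\<close> at most, so the drift of the
  distance is at most \<open>- m * d + (R - m) * (1 - d) = - R * d + (R - m)\<close>. Finally \<open>R\<close> is at least \<open>T\<close>
  plus the infimum, and \<open>R - m\<close> is at most the Lipschitz norm of \<open>f\<close> times the \<open>l\<^sup>1\<close> distance of the
  empirical measures, hence times \<open>2 * d\<close>; if \<open>f\<close> is monotone, only the positive or only the negative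
  part of the difference of the empirical measures enters, and its mass is at most \<open>d\<close>.
\<close>

section \<open>Kantorovich duality on a finite set\<close>

text \<open>The vectors (two marginals, cost) of all probability weights on pairs form the convex
  hull \<open>K\<close> of finitely many points, and a suitable \<open>w\<close> exists once
  \<open>K\<close> meets the ray \<open>R\<close>. Otherwise a hyperplane separates them strictly,
  and its normal yields a Lipschitz \<open>g\<close> contradicting \<open>dual\<close>. Admitting
  \<open>l = 0\<close> in \<open>dual\<close> covers a normal without cost component.\<close>

lemma kantorovich_finite:
  fixes \<mu> \<nu> :: "'s::finite \<Rightarrow> real" and d :: "'s \<Rightarrow> 's \<Rightarrow> real"
  assumes \<mu>: "\<And>x. 0 \<le> \<mu> x" "sum \<mu> UNIV = 1" and \<nu>: "\<And>x. 0 \<le> \<nu> x" "sum \<nu> UNIV = 1"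
    and d: "\<And>x. d x x = 0" "\<And>x y z. d x z \<le> d x y + d y z"
    and dual: "\<And>l g. 0 \<le> l \<Longrightarrow> (\<And>x y. g x - g y \<le> l * d x y)
      \<Longrightarrow> (\<Sum>x\<in>UNIV. \<mu> x * g x) - (\<Sum>x\<in>UNIV. \<nu> x * g x) \<le> l * c"
  obtains w :: "'s \<times> 's \<Rightarrow> real" where "\<And>z. 0 \<le> w z"
    "\<And>x. (\<Sum>y\<in>UNIV. w (x, y)) = \<mu> x" "\<And>y. (\<Sum>x\<in>UNIV. w (x, y)) = \<nu> y"
    "(\<Sum>z\<in>UNIV. w z * d (fst z) (snd z)) \<le> c"
proof -
  define pt :: "'s \<times> 's \<Rightarrow> (real^'s) \<times> (real^'s) \<times> real"
    where "pt z = (axis (fst z) 1, axis (snd z) 1, d (fst z) (snd z))" for z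
  define K where "K = convex hull (range pt)"
  define m n :: "real^'s" where "m = (\<chi> x. \<mu> x)" and "n = (\<chi> x. \<nu> x)"
  define R where "R = {m} \<times> {n} \<times> {..c}"
  have "K \<inter> R \<noteq> {}"
  proof
    assume "K \<inter> R = {}"
    moreover have "convex K" "compact K" "K \<noteq> {}"
      by (auto simp: K_def intro!: finite_imp_compact_convex_hull)
    moreover have "convex R" "closed R"
      by (auto simp: R_def intro!: convex_Times closed_Times)
    ultimately obtain a b where ab: "\<And>v. v \<in> K \<Longrightarrow> a \<bullet> v < b" "\<And>v. v \<in> R \<Longrightarrow> b < a \<bullet> v"
      using separating_hyperplane_compact_closed[of K R] by blast
    obtain \<phi> \<psi> l where a: "a = (\<phi>, \<psi>, l)" by (cases a) auto
    have pt: "\<phi> $ x + \<psi> $ y + l * d x y < b" for x y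
      using ab(1)[OF hull_inc[OF rangeI[of pt "(x, y)"], where P = convex, folded K_def]]
      by (simp add: pt_def a inner_axis add.assoc)
    have ray: "b < \<phi> \<bullet> m + \<psi> \<bullet> n + l * (c - s)" if "0 \<le> s" for s
      using ab(2)[of "(m, n, c - s)"] that by (simp add: R_def a)
    \<comment> \<open>The ray extends to arbitrarily low cost, so with \<open>l > 0\<close> it would
      cross the hyperplane; the length chosen here brings the right side of \<open>ray\<close> down
      to at most \<open>b\<close>.\<close>
    have l: "l \<le> 0"
    proof (rule ccontr)
      assume "\<not> l \<le> 0"
      then show False
        using ray[of "\<bar>\<phi> \<bullet> m + \<psi> \<bullet> n + l * c - b\<bar> / l"] by (simp add: algebra_simps)
    qed
    \<comment> \<open>An infimal convolution: it is Lipschitz with constant \<open>- l\<close> by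
      the triangle inequality, and it replaces both potentials at once, since \<open>\<phi>\<close>
      lies below \<open>b + g\<close> and, as \<open>d x x = 0\<close>, \<open>\<psi>\<close> lies
      below \<open>- g\<close>.\<close>
    define g where "g x = (MIN y. - l * d x y - \<psi> $ y)" for x
    have g_le: "g x \<le> - l * d x y - \<psi> $ y" for x y
      unfolding g_def by (rule Min_le) auto
    have g_at: "\<exists>y. g x = - l * d x y - \<psi> $ y" for x
    proof -
      have "g x \<in> range (\<lambda>y. - l * d x y - \<psi> $ y)" unfolding g_def by (rule Min_in) auto
      then show ?thesis by blast
    qed
    have "g x - g y \<le> - l * d x y" for x y
    proof -
      obtain z where z: "g y = - l * d y z - \<psi> $ z" using g_at by blast
      have "(- l) * d x z \<le> (- l) * (d x y + d y z)"
        using l d(2) by (intro mult_left_mono) auto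
      then show ?thesis using z g_le[of x z] by (simp add: algebra_simps)
    qed
    then have "(\<Sum>x\<in>UNIV. \<mu> x * g x) - (\<Sum>x\<in>UNIV. \<nu> x * g x) \<le> - l * c"
      using l by (intro dual) auto
    moreover have "\<phi> \<bullet> m \<le> (\<Sum>x\<in>UNIV. \<mu> x * (b + g x))"
    proof -
      have "\<phi> $ x \<le> b + g x" for x
      proof -
        obtain y where "g x = - l * d x y - \<psi> $ y" using g_at by blast
        then show ?thesis using pt[of x y] by simp
      qed
      then show ?thesis
        unfolding inner_vec_def m_def
        by (auto intro!: sum_mono simp: mult.commute[of _ "\<mu> _"] \<mu> mult_left_mono)
    qed
    moreover have "\<psi> \<bullet> n \<le> (\<Sum>x\<in>UNIV. \<nu> x * (- g x))"
    proof -
      have "\<nu> x * \<psi> $ x \<le> \<nu> x * (- g x)" for x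
        using g_le[of x x] d(1) \<nu>(1) by (intro mult_left_mono) auto
      then show ?thesis
        unfolding inner_vec_def n_def
        by (intro sum_mono) (simp only: vec_lambda_beta inner_real_def mult.commute[of _ "\<nu> _"])
    qed
    moreover have "(\<Sum>x\<in>UNIV. \<mu> x * (b + g x)) = b + (\<Sum>x\<in>UNIV. \<mu> x * g x)"
      using \<mu>(2) by (simp add: algebra_simps sum.distrib flip: sum_distrib_left)
    ultimately show False using ray[of 0] by (simp add: sum_negf)
  qed
  then obtain c' where c': "(m, n, c') \<in> K" "c' \<le> c" by (auto simp: R_def)
  have "finite (range pt)" by simp
  with c'(1) obtain u where u: "\<And>v. v \<in> range pt \<Longrightarrow> 0 \<le> u v"
      "(\<Sum>v\<in>range pt. u v *\<^sub>R v) = (m, n, c')"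
    unfolding K_def convex_hull_finite[OF \<open>finite (range pt)\<close>] mem_Collect_eq by blast
  \<comment> \<open>Distinct pairs give distinct points, so the convex weights can be read as
    weights on pairs.\<close>
  have inj: "inj pt" by (auto intro!: injI simp: pt_def axis_eq_axis prod_eq_iff)
  define w where "w z = u (pt z)" for z
  have eq: "(\<Sum>z\<in>UNIV. w z *\<^sub>R pt z) = (m, n, c')"
    using u(2) by (simp add: sum.reindex[OF inj] w_def)
  have e1: "(\<Sum>z\<in>UNIV. w z *\<^sub>R (axis (fst z) 1 :: real^'s)) = m"
    and e2: "(\<Sum>z\<in>UNIV. w z *\<^sub>R (axis (snd z) 1 :: real^'s)) = n"
    and e3: "(\<Sum>z\<in>UNIV. w z * d (fst z) (snd z)) = c'"
    using arg_cong[OF eq, of fst] arg_cong[OF eq, of "\<lambda>v. fst (snd v)"]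
      arg_cong[OF eq, of "\<lambda>v. snd (snd v)"]
    by (simp_all add: fst_sum snd_sum pt_def)
  have sum_pair: "sum k UNIV = (\<Sum>a\<in>UNIV. \<Sum>b\<in>UNIV. k (a, b))" for k :: "'s \<times> 's \<Rightarrow> real"
    by (subst sum.cartesian_product) simp
  show thesis
  proof
    show "0 \<le> w z" for z by (simp add: w_def u)
    show "(\<Sum>y\<in>UNIV. w (x, y)) = \<mu> x" for x
    proof -
      have "\<mu> x = (\<Sum>z\<in>UNIV. if x = fst z then w z else 0)"
        using arg_cong[OF e1, of "\<lambda>v. v $ x"] by (simp add: m_def axis_def if_distrib cong: if_cong)
      also have "\<dots> = (\<Sum>b\<in>UNIV. \<Sum>a\<in>UNIV. if x = a then w (a, b) else 0)"
        by (subst sum.swap) (simp only: sum_pair fst_conv)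
      finally show ?thesis by simp
    qed
    show "(\<Sum>x\<in>UNIV. w (x, y)) = \<nu> y" for y
    proof -
      have "\<nu> y = (\<Sum>z\<in>UNIV. if y = snd z then w z else 0)"
        using arg_cong[OF e2, of "\<lambda>v. v $ y"] by (simp add: n_def axis_def if_distrib cong: if_cong)
      also have "\<dots> = (\<Sum>a\<in>UNIV. \<Sum>b\<in>UNIV. if y = b then w (a, b) else 0)"
        by (simp only: sum_pair snd_conv)
      finally show ?thesis by simp
    qed
    show "(\<Sum>z\<in>UNIV. w z * d (fst z) (snd z)) \<le> c" using e3 c'(2) by simp
  qed
qed

lemma wasserstein_finite_le:
  fixes \<mu> \<nu> :: "'s::finite measure" and d :: "'s \<Rightarrow> 's \<Rightarrow> real"
  assumes \<mu>: "prob_space \<mu>" "sets \<mu> = UNIV" and \<nu>: "prob_space \<nu>" "sets \<nu> = UNIV"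
    and d: "\<And>x. d x x = 0" "\<And>x y z. d x z \<le> d x y + d y z" "\<And>x y. 0 \<le> d x y"
    and dual: "\<And>l g. 0 \<le> l \<Longrightarrow> (\<And>x y. g x - g y \<le> l * d x y)
      \<Longrightarrow> (\<Sum>x\<in>UNIV. measure \<mu> {x} * g x) - (\<Sum>x\<in>UNIV. measure \<nu> {x} * g x) \<le> l * c"
  shows "wasserstein d \<mu> \<nu> \<le> ennreal c"
proof -
  interpret \<mu>: prob_space \<mu> by fact
  interpret \<nu>: prob_space \<nu> by fact
  have sp: "space \<mu> = UNIV" "space \<nu> = UNIV"
    using sets_eq_imp_space_eq[of \<mu> "count_space UNIV"] sets_eq_imp_space_eq[of \<nu> "count_space UNIV"]
      \<mu> \<nu> by simp_all
  have ms: "(\<Sum>x\<in>UNIV. measure \<mu> {x}) = 1" "(\<Sum>x\<in>UNIV. measure \<nu> {x}) = 1"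
    using \<mu>.finite_measure_eq_sum_singleton[of UNIV] \<nu>.finite_measure_eq_sum_singleton[of UNIV]
      \<mu>.prob_space \<nu>.prob_space \<mu>(2) \<nu>(2) sp by auto
  obtain w :: "'s \<times> 's \<Rightarrow> real" where w: "\<And>z. 0 \<le> w z"
    "\<And>x. (\<Sum>y\<in>UNIV. w (x, y)) = measure \<mu> {x}" "\<And>y. (\<Sum>x\<in>UNIV. w (x, y)) = measure \<nu> {y}"
    "(\<Sum>z\<in>UNIV. w z * d (fst z) (snd z)) \<le> c"
    using kantorovich_finite[of "\<lambda>x. measure \<mu> {x}" "\<lambda>x. measure \<nu> {x}" d c] ms d dual by auto
  define \<pi> where "\<pi> = point_measure UNIV (\<lambda>z. ennreal (w z))"
  have em: "emeasure \<pi> A = ennreal (sum w A)" for A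
    by (simp add: \<pi>_def emeasure_point_measure_finite w sum_ennreal)
  have sets\<pi>: "sets \<pi> = UNIV" "space \<pi> = UNIV" by (auto simp: \<pi>_def sets_point_measure space_point_measure)
  have s: "sets \<pi> = sets (\<mu> \<Otimes>\<^sub>M \<nu>)"
    using sets_pair_countable[of UNIV UNIV \<mu> \<nu>] \<mu>(2) \<nu>(2) by (simp add: sets\<pi> countable_finite)
  have 1: "distr \<pi> \<mu> fst = \<mu>"
  proof (rule measure_eqI_finite[of _ UNIV])
    fix a :: 's
    have "fst -` {a} = Pair a ` (UNIV :: 's set)" by auto
    then show "emeasure (distr \<pi> \<mu> fst) {a} = emeasure \<mu> {a}"
      using \<mu>(2) by (subst emeasure_distr)
        (auto simp: measurable_def sets\<pi> sp em sum.reindex inj_on_def w \<mu>.emeasure_eq_measure)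
  qed (use \<mu> in auto)
  have 2: "distr \<pi> \<nu> snd = \<nu>"
  proof (rule measure_eqI_finite[of _ UNIV])
    fix a :: 's
    have "snd -` {a} = (\<lambda>x. (x, a)) ` (UNIV :: 's set)" by auto
    then show "emeasure (distr \<pi> \<nu> snd) {a} = emeasure \<nu> {a}"
      using \<nu>(2) by (subst emeasure_distr)
        (auto simp: measurable_def sets\<pi> sp em sum.reindex inj_on_def w \<nu>.emeasure_eq_measure)
  qed (use \<nu> in auto)
  have "wasserstein d \<mu> \<nu> \<le> (\<integral>\<^sup>+ z. ennreal (d (fst z) (snd z)) \<partial>\<pi>)"
    unfolding wasserstein_def by (rule INF_lower) (use s 1 2 in \<open>auto simp: couplings_def\<close>)
  also have "\<dots> = ennreal (\<Sum>z\<in>UNIV. w z * d (fst z) (snd z))"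
    by (simp add: \<pi>_def nn_integral_point_measure_finite sum_ennreal w d flip: ennreal_mult)
  finally show ?thesis using w(4) by (meson ennreal_leI order_trans)
qed


section \<open>Lipschitz contraction of the semigroup\<close>

definition transition ::
  "('s \<Rightarrow> 'w measure) \<Rightarrow> (real \<Rightarrow> 'w \<Rightarrow> 's) \<Rightarrow> real \<Rightarrow> 's \<Rightarrow> 's \<Rightarrow> real" where
  "transition M X t x z = measure (law_at M X t x) {z}"

lemma markov_processD:
  fixes M :: "'s::finite \<Rightarrow> 'w measure"
  assumes "markov_process M X"
  shows markov_process_prob_space: "prob_space (M x)"
    and markov_process_measurable: "0 \<le> t \<Longrightarrow> X t \<in> M x \<rightarrow>\<^sub>M count_space UNIV"
    and markov_process_start: "AE \<omega> in M x. X 0 \<omega> = x"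
  using assms by (auto simp: markov_process_def)

lemma transition_eq:
  assumes "markov_process M X" "0 \<le> t"
  shows "transition M X t x z = measure (M x) {\<omega>\<in>space (M x). X t \<omega> = z}"
  using markov_process_measurable[OF assms]
  by (auto simp: transition_def law_at_def measure_distr intro!: arg_cong[of _ _ "measure (M x)"])

lemma prob_space_law_at:
  assumes "markov_process M X" "0 \<le> t"
  shows "prob_space (law_at M X t x)"
  unfolding law_at_def using markov_process_prob_space[OF assms(1)] markov_process_measurable[OF assms]
  by (rule prob_space.prob_space_distr)

lemma transition_nonneg: "0 \<le> transition M X t x z"
  by (simp add: transition_def)

lemma sum_transition:
  fixes M :: "'s::finite \<Rightarrow> 'w measure"
  assumes "markov_process M X" "0 \<le> t"
  shows "(\<Sum>z\<in>UNIV. transition M X t x z) = 1"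
proof -
  interpret prob_space "law_at M X t x" by (rule prob_space_law_at[OF assms])
  show ?thesis
    using finite_measure_eq_sum_singleton[of UNIV] prob_space
    by (simp add: transition_def law_at_def)
qed

lemma transition_0:
  assumes "markov_process M X"
  shows "transition M X 0 x z = of_bool (x = z)"
proof -
  interpret prob_space "M x" by (rule markov_process_prob_space[OF assms])
  have start: "AE \<omega> in M x. X 0 \<omega> = x" by (rule markov_process_start[OF assms])
  have "{\<omega>\<in>space (M x). X 0 \<omega> = z} \<in> sets (M x)"
    using measurable_sets[OF markov_process_measurable[OF assms order_refl], of "{z}" x]
    by (simp add: vimage_def Int_def conj_commute)
  moreover have "prob {\<omega>\<in>space (M x). X 0 \<omega> = z} = of_bool (x = z)"
  proof (cases "x = z")
    case True
    with start show ?thesis using prob_eq_1[of "{\<omega>\<in>space (M x). X 0 \<omega> = z}"] calculation by auto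
  next
    case False
    with start show ?thesis using prob_eq_0[of "{\<omega>\<in>space (M x). X 0 \<omega> = z}"] calculation by auto
  qed
  ultimately show ?thesis using assms by (simp add: transition_eq)
qed

lemma transition_add:
  assumes "markov_process M X" "0 \<le> s" "0 \<le> t"
  shows "transition M X (s + t) x z = (\<Sum>y\<in>UNIV. transition M X s x y * transition M X t y z)"
proof -
  \<comment> \<open>Chapman-Kolmogorov is the Markov property applied to the sure event.\<close>
  have "space (M x) \<in> history (M x) X s" by (simp add: history_def sigma_sets_top)
  then show ?thesis using assms by (simp add: transition_eq) (simp add: markov_process_def)
qed

lemma integral_law_at:
  fixes M :: "'s::finite \<Rightarrow> 'w measure" and g :: "'s \<Rightarrow> real"
  assumes "markov_process M X" "0 \<le> t"
  shows "(\<integral>\<omega>. g (X t \<omega>) \<partial>M x) = (\<Sum>z\<in>UNIV. transition M X t x z * g z)"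
proof -
  interpret prob_space "M x" by (rule markov_process_prob_space[OF assms(1)])
  define A where "A z = {\<omega>\<in>space (M x). X t \<omega> = z}" for z
  have A: "A z \<in> sets (M x)" for z
    using measurable_sets[OF markov_process_measurable[OF assms], of "{z}" x]
    by (simp add: A_def vimage_def Int_def conj_commute)
  have "(\<integral>\<omega>. g (X t \<omega>) \<partial>M x) = (\<integral>\<omega>. (\<Sum>z\<in>UNIV. indicator (A z) \<omega> * g z) \<partial>M x)"
  proof (intro Bochner_Integration.integral_cong refl)
    fix \<omega> assume "\<omega> \<in> space (M x)"
    then have "indicator (A z) \<omega> * g z = (if X t \<omega> = z then g z else 0)" for z
      by (simp add: A_def indicator_def)
    then show "g (X t \<omega>) = (\<Sum>z\<in>UNIV. indicator (A z) \<omega> * g z)" by simp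
  qed
  also have "\<dots> = (\<Sum>z\<in>UNIV. prob (A z) * g z)"
    using A by (subst Bochner_Integration.integral_sum) (auto simp: emeasure_eq_measure)
  finally show ?thesis using assms by (simp add: transition_eq A_def)
qed

lemma generator_indicator:
  fixes M :: "'s::finite \<Rightarrow> 'w measure"
  assumes "markov_process M X" "has_generator M X L"
  shows "((\<lambda>t. (transition M X t x z - of_bool (x = z)) / t) \<longlongrightarrow> L (\<lambda>w. of_bool (w = z)) x) (at_right 0)"
proof (rule Lim_transform_eventually)
  show "((\<lambda>t. ((\<integral>\<omega>. of_bool (X t \<omega> = z) \<partial>M x) - of_bool (x = z)) / t)
      \<longlongrightarrow> L (\<lambda>w. of_bool (w = z)) x) (at_right 0)"
    using assms(2)[unfolded has_generator_def, rule_format, of x "\<lambda>w. of_bool (w = z)"] by simp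
  show "\<forall>\<^sub>F t in at_right 0. ((\<integral>\<omega>. of_bool (X t \<omega> = z) \<partial>M x) - of_bool (x = z)) / t
      = (transition M X t x z - of_bool (x = z)) / t"
    using eventually_at_right_less[of 0]
  proof eventually_elim
    case (elim t)
    then show ?case
      using integral_law_at[OF assms(1), of t x "\<lambda>w. of_bool (w = z)"] by simp
  qed
qed

text \<open>\<open>has_generator\<close> prescribes a limit separately for each \<open>g\<close>.
  Linearity of \<open>L\<close> comes from linearity of the difference quotients and uniqueness of
  limits, so \<open>L\<close> is given by the rate matrix read off from indicators of
  points.\<close>

lemma generator_linear:
  fixes M :: "'s::finite \<Rightarrow> 'w measure"
  assumes "markov_process M X" "has_generator M X L"
  shows "L g x = (\<Sum>z\<in>UNIV. g z * L (\<lambda>w. of_bool (w = z)) x)"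
proof (rule tendsto_unique)
  show "((\<lambda>t. \<Sum>z\<in>UNIV. g z * ((transition M X t x z - of_bool (x = z)) / t))
      \<longlongrightarrow> (\<Sum>z\<in>UNIV. g z * L (\<lambda>w. of_bool (w = z)) x)) (at_right 0)"
    by (intro tendsto_intros generator_indicator assms)
  show "((\<lambda>t. \<Sum>z\<in>UNIV. g z * ((transition M X t x z - of_bool (x = z)) / t)) \<longlongrightarrow> L g x) (at_right 0)"
  proof (rule Lim_transform_eventually)
    show "((\<lambda>t. ((\<integral>\<omega>. g (X t \<omega>) \<partial>M x) - g x) / t) \<longlongrightarrow> L g x) (at_right 0)"
      using assms(2) by (simp add: has_generator_def)
    show "\<forall>\<^sub>F t in at_right 0. ((\<integral>\<omega>. g (X t \<omega>) \<partial>M x) - g x) / t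
        = (\<Sum>z\<in>UNIV. g z * ((transition M X t x z - of_bool (x = z)) / t))"
      using eventually_at_right_less[of 0]
    proof eventually_elim
      case (elim t)
      have "(\<Sum>z\<in>UNIV. g z * of_bool (x = z)) = g x" by simp
      then have "(\<integral>\<omega>. g (X t \<omega>) \<partial>M x) - g x
          = (\<Sum>z\<in>UNIV. g z * (transition M X t x z - of_bool (x = z)))"
        using elim
        by (simp add: integral_law_at[OF assms(1)] right_diff_distrib sum_subtractf mult.commute)
      then show ?case by (simp add: sum_divide_distrib)
    qed
  qed
qed auto

text \<open>
  In the hypothesis on \<open>L\<close> below, the slack \<open>d x y - (g x - g y)\<close> may be multiplied by an arbitrarily
  large \<open>K\<close>: as \<open>K\<close> does not depend on \<open>g\<close>, the factor \<open>1 - K * h\<close> of the slack after a time step \<open>h\<close>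
  is nonnegative once \<open>h\<close> is small.
\<close>

lemma small_time_contraction:
  fixes M :: "'s::finite \<Rightarrow> 'w measure" and d :: "'s \<Rightarrow> 's \<Rightarrow> real"
  assumes M: "markov_process M X" and gen: "has_generator M X L"
    and d: "\<And>x. d x x = 0" "\<And>x y. d x y = d y x" "\<And>x y. x \<noteq> y \<Longrightarrow> 0 < d x y"
    and L: "\<And>x y. x \<noteq> y \<Longrightarrow> \<exists>K. \<forall>g. (\<forall>u v. g u - g v \<le> d u v)
       \<longrightarrow> L g x - L g y \<le> K * (d x y - (g x - g y)) - \<sigma> * d x y"
    and s: "s < \<sigma>"
  shows "\<forall>\<^sub>F h in at_right 0. \<forall>x y. \<forall>g. (\<forall>u v. g u - g v \<le> d u v) \<longrightarrow>
     (\<Sum>z\<in>UNIV. transition M X h x z * g z) - (\<Sum>z\<in>UNIV. transition M X h y z * g z)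
       \<le> exp (- s * h) * d x y"
proof (intro eventually_all_finite)
  fix x y :: 's
  let ?P = "\<lambda>h g x. \<Sum>z\<in>UNIV. transition M X h x z * g z"
  show "\<forall>\<^sub>F h in at_right 0. \<forall>g. (\<forall>u v. g u - g v \<le> d u v) \<longrightarrow> ?P h g x - ?P h g y \<le> exp (- s * h) * d x y"
  proof (cases "x = y")
    case True
    then show ?thesis by (simp add: d)
  next
    case False
    obtain K where K: "\<And>g. (\<And>u v. g u - g v \<le> d u v)
        \<Longrightarrow> L g x - L g y \<le> K * (d x y - (g x - g y)) - \<sigma> * d x y"
      using L[OF False] by blast
    define q where "q x z = L (\<lambda>w. of_bool (w = z)) x" for x z
    \<comment> \<open>The error of the difference quotient is measured entrywise, without
      \<open>g\<close>; hence one threshold for \<open>h\<close> serves all Lipschitz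
      \<open>g\<close> simultaneously.\<close>
    define r where "r h x z = \<bar>(transition M X h x z - of_bool (x = z)) / h - q x z\<bar>" for h x z
    have "((\<lambda>h. \<Sum>z\<in>UNIV. (r h x z + r h y z) * d x z)
        \<longlongrightarrow> (\<Sum>z\<in>UNIV. (\<bar>q x z - q x z\<bar> + \<bar>q y z - q y z\<bar>) * d x z)) (at_right 0)"
      unfolding q_def r_def by (intro tendsto_intros generator_indicator M gen)
    moreover have pos: "0 < (\<sigma> - s) * d x y" using s d False by auto
    ultimately have "\<forall>\<^sub>F h in at_right 0. (\<Sum>z\<in>UNIV. (r h x z + r h y z) * d x z) < (\<sigma> - s) * d x y"
      by (intro order_tendstoD) simp_all
    moreover have "((\<lambda>h. K * h) \<longlongrightarrow> K * 0) (at_right 0)" by (intro tendsto_intros)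
    then have "\<forall>\<^sub>F h in at_right 0. K * h < 1" by (rule order_tendstoD) simp
    ultimately show ?thesis using eventually_at_right_less[of 0]
    proof (eventually_elim, intro allI impI)
      fix h :: real and g :: "'s \<Rightarrow> real"
      assume small: "(\<Sum>z\<in>UNIV. (r h x z + r h y z) * d x z) < (\<sigma> - s) * d x y" and Kh: "K * h < 1"
        and h: "0 < h" and g: "\<forall>u v. g u - g v \<le> d u v"
      \<comment> \<open>Subtracting a constant changes no difference of expectations, because
        transition probabilities sum to 1; vanishing at \<open>x\<close> bounds \<open>k z\<close>
        by \<open>d x z\<close>, which matches the weights in \<open>small\<close>.\<close>
      define k where "k z = g z - g x" for z
      have k: "k u - k v \<le> d u v" for u v using g by (simp add: k_def)
      have kd: "\<bar>k z\<bar> \<le> d x z" for z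
        using g[rule_format, of x z] g[rule_format, of z x] d(2)[of x z] by (auto simp: k_def)
      have P_eq: "?P h g v = ?P h k v + g x" for v
        using sum_transition[OF M, of h v] h
        by (simp add: k_def algebra_simps sum_subtractf flip: sum_distrib_left sum_distrib_right)
      have P_err: "\<bar>?P h k v - (k v + h * L k v)\<bar> \<le> h * (\<Sum>z\<in>UNIV. r h v z * d x z)" for v
      proof -
        have "(\<Sum>z\<in>UNIV. of_bool (v = z) * k z) = k v" by simp
        moreover have "h * L k v = (\<Sum>z\<in>UNIV. h * q v z * k z)"
          by (subst generator_linear[OF M gen]) (simp add: q_def sum_distrib_left mult_ac)
        ultimately have "?P h k v - (k v + h * L k v)
            = (\<Sum>z\<in>UNIV. (transition M X h v z - of_bool (v = z) - h * q v z) * k z)"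
          by (simp add: left_diff_distrib sum_subtractf)
        also have "\<dots> = (\<Sum>z\<in>UNIV. h * (((transition M X h v z - of_bool (v = z)) / h - q v z) * k z))"
          using h by (intro sum.cong) (auto simp: field_simps)
        also have "\<bar>\<dots>\<bar> \<le> (\<Sum>z\<in>UNIV. h * (r h v z * d x z))"
          using h kd by (intro order_trans[OF sum_abs] sum_mono)
            (auto simp: abs_mult r_def intro!: mult_left_mono)
        finally show ?thesis by (simp add: sum_distrib_left)
      qed
      have "?P h g x - ?P h g y = ?P h k x - ?P h k y" by (simp add: P_eq)
      also have "\<dots> \<le> (k x - k y) + h * (L k x - L k y) + h * (\<Sum>z\<in>UNIV. (r h x z + r h y z) * d x z)"
        using P_err[of x] P_err[of y] by (simp add: algebra_simps sum.distrib)
      \<comment> \<open>The gap between \<open>s\<close> and \<open>\<sigma>\<close> absorbs the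
        first-order error.\<close>
      also have "\<dots> \<le> (k x - k y) + h * (K * (d x y - (k x - k y)) - \<sigma> * d x y) + h * ((\<sigma> - s) * d x y)"
        using K[of k] k small h by (intro add_mono mult_left_mono) auto
      also have "\<dots> = d x y - (1 - K * h) * (d x y - (k x - k y)) - s * h * d x y"
        by (simp add: algebra_simps)
      also have "\<dots> \<le> (1 + (- s * h)) * d x y"
        using mult_nonneg_nonneg[of "1 - K * h" "d x y - (k x - k y)"] Kh k[of x y]
        by (simp add: left_diff_distrib)
      also have "\<dots> \<le> exp (- s * h) * d x y"
        using d(3)[OF False] by (intro mult_right_mono exp_ge_add_one_self) auto
      finally show "?P h g x - ?P h g y \<le> exp (- s * h) * d x y" .
    qed
  qed
qed

text \<open>Time \<open>t\<close> is cut into equal steps short enough for \<open>ev\<close>. Each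
  step multiplies the Lipschitz constant by \<open>exp (- s * h)\<close>, and by the semigroup
  property these factors multiply to \<open>exp (- s * t)\<close>.\<close>

lemma contraction:
  fixes M :: "'s::finite \<Rightarrow> 'w measure" and d :: "'s \<Rightarrow> 's \<Rightarrow> real"
  assumes M: "markov_process M X"
    and ev: "\<forall>\<^sub>F h in at_right 0. \<forall>x y. \<forall>g. (\<forall>u v. g u - g v \<le> d u v) \<longrightarrow>
     (\<Sum>z\<in>UNIV. transition M X h x z * g z) - (\<Sum>z\<in>UNIV. transition M X h y z * g z)
       \<le> exp (- s * h) * d x y"
    and t: "0 \<le> t" and l: "0 \<le> l" and g: "\<And>u v. g u - g v \<le> l * d u v"
  shows "(\<Sum>z\<in>UNIV. transition M X t x z * g z) - (\<Sum>z\<in>UNIV. transition M X t y z * g z)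
       \<le> l * (exp (- s * t) * d x y)"
proof (cases "t = 0")
  case True
  then show ?thesis using g by (simp add: transition_0[OF M])
next
  case False
  with t have "0 < t" by simp
  let ?P = "\<lambda>h g x. \<Sum>z\<in>UNIV. transition M X h x z * g z"
  have "filterlim (\<lambda>n. t / real (Suc n)) (at_right 0) sequentially"
    by (intro tendsto_imp_filterlim_at_right LIMSEQ_Suc[OF lim_const_over_n] always_eventually allI)
      (use \<open>0 < t\<close> in \<open>simp add: zero_less_divide_iff add_pos_nonneg\<close>)
  with ev have "\<forall>\<^sub>F n in sequentially. \<forall>x y. \<forall>g. (\<forall>u v. g u - g v \<le> d u v) \<longrightarrow>
      ?P (t / Suc n) g x - ?P (t / Suc n) g y \<le> exp (- s * (t / Suc n)) * d x y"
    by (rule eventually_compose_filterlim)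
  then obtain n where n: "\<And>x y g. (\<And>u v. g u - g v \<le> d u v) \<Longrightarrow>
      ?P (t / Suc n) g x - ?P (t / Suc n) g y \<le> exp (- s * (t / Suc n)) * d x y"
    unfolding eventually_sequentially by blast
  define h where "h = t / Suc n"
  have h: "0 \<le> h" "t = Suc n * h" using t by (auto simp: h_def)
  \<comment> \<open>Scaling carries the one-step bound from constant 1 to constant \<open>l\<close>;
    for \<open>l = 0\<close> the function is constant and is preserved.\<close>
  have step: "?P h g x - ?P h g y \<le> l * (exp (- s * h) * d x y)"
    if l: "0 \<le> l" and g: "\<And>u v. g u - g v \<le> l * d u v" for l g x y
  proof (cases "l = 0")
    case True
    then have "g = (\<lambda>_. g x)" using g by (intro ext antisym) (simp_all add: field_simps)
    then obtain c where "g = (\<lambda>_. c)" by blast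
    then have "?P h g v = c" for v
      using sum_transition[OF M h(1), of v] by (simp flip: sum_distrib_right)
    then show ?thesis using True by simp
  next
    case False
    with l have "0 < l" by simp
    with g have "?P h (\<lambda>z. g z / l) x - ?P h (\<lambda>z. g z / l) y \<le> exp (- s * h) * d x y"
      unfolding h_def by (intro n) (simp add: field_simps)
    with \<open>0 < l\<close> show ?thesis by (simp add: field_simps flip: sum_divide_distrib)
  qed
  have "?P (real m * h) g x - ?P (real m * h) g y \<le> l * (exp (- s * (real m * h)) * d x y)" for m x y
  proof (induction m arbitrary: x y)
    case 0
    then show ?case using g by (simp add: transition_0[OF M])
  next
    case (Suc m)
    \<comment> \<open>The new step acts outermost, on a function whose Lipschitz constant the
      induction hypothesis has already reduced.\<close>
    have "?P (real (Suc m) * h) g x = ?P h (?P (real m * h) g) x" for x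
    proof -
      have "?P (real (Suc m) * h) g x =
          (\<Sum>z\<in>UNIV. \<Sum>y\<in>UNIV. transition M X h x y * transition M X (real m * h) y z * g z)"
        using transition_add[OF M h(1), of "real m * h" x] h(1)
        by (simp add: distrib_right sum_distrib_right)
      then show ?thesis by (subst (asm) sum.swap) (simp add: sum_distrib_left mult_ac)
    qed
    then have "?P (real (Suc m) * h) g x - ?P (real (Suc m) * h) g y
        \<le> (l * exp (- s * (real m * h))) * (exp (- s * h) * d x y)"
      using step[of "l * exp (- s * (real m * h))" "?P (real m * h) g" x y] Suc.IH l
      by (simp add: mult.assoc)
    also have "\<dots> = l * (exp (- s * (real (Suc m) * h)) * d x y)"
      by (simp add: exp_add[symmetric] algebra_simps)
    finally show ?case .
  qed
  from this[of "Suc n"] h(2) show ?thesis by simp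
qed

text \<open>The small-time estimate needs a strict gap, so each \<open>s < \<sigma>\<close> is shown
  to be a curvature bound, and density of the order recovers \<open>\<sigma>\<close> itself.\<close>

lemma coarse_ricci_ge:
  fixes M :: "'s::finite \<Rightarrow> 'w measure" and d :: "'s \<Rightarrow> 's \<Rightarrow> real"
  assumes M: "markov_process M X" and gen: "has_generator M X L"
    and d: "\<And>x. d x x = 0" "\<And>x y. d x y = d y x" "\<And>x y. x \<noteq> y \<Longrightarrow> 0 < d x y"
      "\<And>x y z. d x z \<le> d x y + d y z"
    and L: "\<And>x y. x \<noteq> y \<Longrightarrow> \<exists>K. \<forall>g. (\<forall>u v. g u - g v \<le> d u v)
       \<longrightarrow> L g x - L g y \<le> K * (d x y - (g x - g y)) - \<sigma> * d x y"
  shows "ereal \<sigma> \<le> coarse_ricci M X d"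
proof -
  have d0: "0 \<le> d x y" for x y using d(1)[of x] d(3)[of x y] by (cases "x = y") auto
  have "ereal s \<in> curvature_bounds M X d" if s: "s < \<sigma>" for s
    unfolding curvature_bounds_def mem_Collect_eq
  proof (intro allI impI)
    fix t :: real and x y assume t: "0 \<le> t"
    have "wasserstein d (law_at M X t x) (law_at M X t y) \<le> ennreal (exp (- s * t) * d x y)"
    proof (rule wasserstein_finite_le)
      fix l :: real and g assume lg: "0 \<le> l" "\<And>u v. g u - g v \<le> l * d u v"
      show "(\<Sum>z\<in>UNIV. measure (law_at M X t x) {z} * g z) - (\<Sum>z\<in>UNIV. measure (law_at M X t y) {z} * g z)
          \<le> l * (exp (- s * t) * d x y)"
        using contraction[OF M small_time_contraction[OF M gen d(1-3) L s] t lg]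
        by (simp add: transition_def)
    qed (use prob_space_law_at[OF M t] d(1,4) d0 in \<open>auto simp: law_at_def\<close>)
    then show "wasserstein d (law_at M X t x) (law_at M X t y)
        \<le> exp_ereal (- (ereal s * ereal t)) * ennreal (d x y)"
      by (simp add: ennreal_mult d0)
  qed
  then have le: "ereal s \<le> coarse_ricci M X d" if "s < \<sigma>" for s
    unfolding coarse_ricci_def using that by (intro Sup_upper)
  show ?thesis
  proof (rule dense_le)
    fix a assume "a < ereal \<sigma>"
    then show "a \<le> coarse_ricci M X d" using le by (cases a) auto
  qed
qed


section \<open>Coupling of the particle system\<close>

lemma config_dist_metric:
  fixes x y z :: "'e ^ 'n"
  shows config_dist_self: "config_dist x x = 0"
    and config_dist_commute: "config_dist x y = config_dist y x"
    and config_dist_pos: "x \<noteq> y \<Longrightarrow> 0 < config_dist x y"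
    and config_dist_triangle: "config_dist x z \<le> config_dist x y + config_dist y z"
proof -
  show "config_dist x x = 0" "config_dist x y = config_dist y x"
    by (simp_all add: config_dist_def eq_commute)
  show "config_dist x z \<le> config_dist x y + config_dist y z"
    unfolding config_dist_def distrib_left[symmetric] sum.distrib[symmetric]
    by (intro mult_left_mono sum_mono) auto
  assume "x \<noteq> y"
  then obtain i where "x $ i \<noteq> y $ i" by (auto simp: vec_eq_iff)
  then have "0 < (\<Sum>i\<in>UNIV. of_bool (x $ i \<noteq> y $ i) :: real)"
    by (intro sum_pos2[where i = i]) auto
  then show "0 < config_dist x y" by (simp add: config_dist_def)
qed

lemma config_dist_jump:
  fixes x y :: "'e ^ 'n"
  shows "config_dist (jump x i z) (jump y i w)
    = config_dist x y - of_bool (x $ i \<noteq> y $ i) / real CARD('n) + of_bool (z \<noteq> w) / real CARD('n)"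
proof -
  have "(\<Sum>j\<in>UNIV. of_bool (jump x i z $ j \<noteq> jump y i w $ j) :: real)
      = of_bool (z \<noteq> w) + (\<Sum>j\<in>UNIV - {i}. of_bool (x $ j \<noteq> y $ j))"
    by (subst sum.remove[of _ i]) (auto simp: jump_def intro!: sum.cong)
  moreover have "(\<Sum>j\<in>UNIV. of_bool (x $ j \<noteq> y $ j) :: real)
      = of_bool (x $ i \<noteq> y $ i) + (\<Sum>j\<in>UNIV - {i}. of_bool (x $ j \<noteq> y $ j))"
    by (subst sum.remove[of _ i]) auto
  ultimately show ?thesis
    by (simp add: config_dist_def add_divide_distrib)
qed

lemma empirical_nonneg: "0 \<le> empirical x z"
  by (simp add: empirical_def sum_nonneg)

lemma empirical_le_1: "empirical x z \<le> 1"
proof -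
  have "(\<Sum>j\<in>UNIV. of_bool (x $ j = z) :: real) \<le> (\<Sum>j\<in>(UNIV :: 'b set). 1)"
    by (intro sum_mono) auto
  then show ?thesis by (simp add: empirical_def)
qed

text \<open>The empirical measure is the law of the label of a uniformly chosen particle. This makes
  it a competitor in the infimum over \<open>'e pmf\<close>.\<close>

lemma empirical_pmf:
  fixes x :: "'e ^ 'n"
  shows "pmf (map_pmf (($) x) (pmf_of_set UNIV)) z = empirical x z"
proof -
  have "pmf (map_pmf (($) x) (pmf_of_set UNIV)) z = real (card {j. x $ j = z}) / real CARD('n)"
    by (simp add: pmf_map measure_pmf_of_set vimage_def)
  then show ?thesis by (simp add: empirical_def of_bool_def sum.If_cases)
qed

text \<open>A particle adds to the excess at \<open>z\<close> only if it sits at \<open>z\<close> in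
  \<open>x\<close> and elsewhere in \<open>y\<close>, so over all \<open>z\<close> each differing
  particle counts at most once. The full l^1 distance would cost a factor 2.\<close>

lemma empirical_excess_le:
  fixes x y :: "('e::finite) ^ 'n"
  shows "(\<Sum>z\<in>UNIV. max 0 (empirical x z - empirical y z)) \<le> config_dist x y"
proof -
  have "max 0 (empirical x z - empirical y z)
      \<le> (\<Sum>j\<in>UNIV. of_bool (x $ j = z \<and> x $ j \<noteq> y $ j)) / real CARD('n)" for z
  proof -
    have "(\<Sum>j\<in>UNIV. of_bool (x $ j = z)) - (\<Sum>j\<in>UNIV. of_bool (y $ j = z))
        \<le> (\<Sum>j\<in>UNIV. of_bool (x $ j = z \<and> x $ j \<noteq> y $ j) :: real)"
      unfolding sum_subtractf[symmetric] by (intro sum_mono) auto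
    then show ?thesis
      by (auto simp: empirical_def diff_divide_distrib[symmetric] divide_right_mono sum_nonneg)
  qed
  then have "(\<Sum>z\<in>UNIV. max 0 (empirical x z - empirical y z))
      \<le> (\<Sum>z\<in>UNIV. (\<Sum>j\<in>UNIV. of_bool (x $ j = z \<and> x $ j \<noteq> y $ j)) / real CARD('n))"
    by (intro sum_mono)
  also have "\<dots> = (\<Sum>j\<in>UNIV. \<Sum>z\<in>UNIV. of_bool (x $ j = z \<and> x $ j \<noteq> y $ j)) / real CARD('n)"
    by (subst sum.swap) (simp flip: sum_divide_distrib)
  also have "\<dots> = config_dist x y"
    by (simp add: config_dist_def of_bool_conj flip: sum_distrib_right)
  finally show ?thesis .
qed

text \<open>
  The dual form of the maximal coupling of the jumps of one particle: the particle jumps in both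
  configurations to the same \<open>z\<close> at rate \<open>min (r z) (r' z)\<close>, and the remaining jumps are paired with each
  other (or with no jump) at total rate \<open>max (sum r UNIV) (sum r' UNIV) - m\<close>.
\<close>

lemma coupled_jump_bound:
  fixes r r' u v :: "'e::finite \<Rightarrow> real"
  assumes r: "\<And>z. 0 \<le> r z" "\<And>z. 0 \<le> r' z"
    and uv: "\<And>z. u z - v z \<le> d0" "\<And>z w. u z - v w \<le> d1"
    and m: "m = (\<Sum>z\<in>UNIV. min (r z) (r' z))"
  shows "(\<Sum>z\<in>UNIV. (u z - u a) * r z) - (\<Sum>z\<in>UNIV. (v z - v b) * r' z)
    \<le> m * (d0 - (u a - v b)) + (max (sum r UNIV) (sum r' UNIV) - m) * (d1 - (u a - v b))"
proof -
  define k where "k z = min (r z) (r' z)" for z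
  define A B where "A = (\<Sum>z\<in>UNIV. r z - k z)" and "B = (\<Sum>z\<in>UNIV. r' z - k z)"
  have A: "A = sum r UNIV - m" and B: "B = sum r' UNIV - m"
    by (simp_all add: A_def B_def m k_def sum_subtractf)
  have nonneg: "0 \<le> A" "0 \<le> B" by (auto simp: A_def B_def k_def intro!: sum_nonneg)
  \<comment> \<open>Unmatched jumps are estimated by the most unfavourable targets.\<close>
  define \<alpha> \<beta> where "\<alpha> = Max (range u)" and "\<beta> = Min (range v)"
  have \<alpha>: "u z \<le> \<alpha>" and \<beta>: "\<beta> \<le> v z" for z by (auto simp: \<alpha>_def \<beta>_def)
  have "\<alpha> \<in> range u" "\<beta> \<in> range v" unfolding \<alpha>_def \<beta>_def by (auto intro: Max_in Min_in)
  with uv(2) have ab: "\<alpha> - \<beta> \<le> d1" by auto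
  have "(\<Sum>z\<in>UNIV. (u z - u a) * r z) - (\<Sum>z\<in>UNIV. (v z - v b) * r' z)
      = (\<Sum>z\<in>UNIV. k z * (u z - v z - (u a - v b))) + (\<Sum>z\<in>UNIV. (r z - k z) * (u z - u a))
        + (\<Sum>z\<in>UNIV. (r' z - k z) * (v b - v z))"
    unfolding sum.distrib[symmetric] sum_subtractf[symmetric]
    by (intro sum.cong) (auto simp: algebra_simps)
  also have "\<dots> \<le> (\<Sum>z\<in>UNIV. k z * (d0 - (u a - v b))) + (\<Sum>z\<in>UNIV. (r z - k z) * (\<alpha> - u a))
        + (\<Sum>z\<in>UNIV. (r' z - k z) * (v b - \<beta>))"
    using uv(1) r \<alpha> \<beta> by (intro add_mono sum_mono mult_left_mono) (auto simp: k_def)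
  also have "\<dots> = m * (d0 - (u a - v b)) + (A * (\<alpha> - u a) + B * (v b - \<beta>))"
    by (simp add: A_def B_def m k_def sum_distrib_right)
  \<comment> \<open>Both factors \<open>\<alpha> - u a\<close> and \<open>v b - \<beta>\<close> are
    nonnegative, so the smaller leftover rate may be raised to the larger; this is the pairing with
    no jump.\<close>
  also have "\<dots> \<le> m * (d0 - (u a - v b)) + (max A B * (\<alpha> - u a) + max A B * (v b - \<beta>))"
    using \<alpha> \<beta> by - (rule add_left_mono, intro add_mono mult_right_mono, auto)
  also have "\<dots> = m * (d0 - (u a - v b)) + max A B * (\<alpha> - \<beta> - (u a - v b))"
    by (simp add: algebra_simps)
  also have "\<dots> \<le> m * (d0 - (u a - v b)) + max A B * (d1 - (u a - v b))"
    using ab nonneg by - (rule add_left_mono, intro mult_left_mono, auto)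
  also have "max A B = max (sum r UNIV) (sum r' UNIV) - m" by (auto simp: A B)
  finally show ?thesis .
qed

lemma particle_generator_contraction:
  fixes x y :: "('e::finite) ^ 'n" and f :: "real \<Rightarrow> real" and T :: real
  defines "r \<equiv> \<lambda>x z. T / real CARD('e) + f (empirical x z)"
  defines "R \<equiv> max (sum (r x) UNIV) (sum (r y) UNIV)"
  assumes r: "\<And>x z. 0 \<le> r x z" and g: "\<And>u v. g u - g v \<le> config_dist u v"
  shows "particle_generator T f g x - particle_generator T f g y
    \<le> real CARD('n) * R * (config_dist x y - (g x - g y)) - R * config_dist x y
      + (R - (\<Sum>z\<in>UNIV. min (r x z) (r y z)))"
proof -
  define m where "m = (\<Sum>z\<in>UNIV. min (r x z) (r y z))"
  define N where "N = real CARD('n)"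
  have N: "N > 0" by (simp add: N_def)
  define D where "D = config_dist x y"
  define \<delta> where "\<delta> = g x - g y"
  \<comment> \<open>A jump to the present label is no jump, so \<open>g x\<close> and
    \<open>g y\<close> become the values \<open>u a\<close> and \<open>v b\<close> of
    \<open>coupled_jump_bound\<close>.\<close>
  have jump_self: "jump x i (x $ i) = x" for x :: "'e ^ 'n" and i
    by (simp add: jump_def vec_eq_iff)
  have "particle_generator T f g x - particle_generator T f g y
      = (\<Sum>i\<in>UNIV. (\<Sum>z\<in>UNIV. (g (jump x i z) - g x) * r x z) - (\<Sum>z\<in>UNIV. (g (jump y i z) - g y) * r y z))"
    by (simp add: particle_generator_def r_def sum_subtractf)
  also have "\<dots> \<le> (\<Sum>i\<in>UNIV. m * (D - of_bool (x $ i \<noteq> y $ i) / N - \<delta>)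
      + (R - m) * (D - of_bool (x $ i \<noteq> y $ i) / N + 1 / N - \<delta>))"
  proof (rule sum_mono)
    fix i
    have jd: "g (jump x i z) - g (jump y i w)
        \<le> D - of_bool (x $ i \<noteq> y $ i) / N + of_bool (z \<noteq> w) / N" for z w
      using g[of "jump x i z" "jump y i w"] by (simp add: config_dist_jump D_def N_def)
    have "(\<Sum>z\<in>UNIV. (g (jump x i z) - g (jump x i (x $ i))) * r x z)
        - (\<Sum>z\<in>UNIV. (g (jump y i z) - g (jump y i (y $ i))) * r y z)
      \<le> m * (D - of_bool (x $ i \<noteq> y $ i) / N - (g (jump x i (x $ i)) - g (jump y i (y $ i))))
      + (R - m) * (D - of_bool (x $ i \<noteq> y $ i) / N + 1 / N - (g (jump x i (x $ i)) - g (jump y i (y $ i))))"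
      unfolding R_def
    proof (rule coupled_jump_bound)
      fix z w
      show "g (jump x i z) - g (jump y i z) \<le> D - of_bool (x $ i \<noteq> y $ i) / N"
        using jd[of z z] by simp
      have "of_bool (z \<noteq> w) / N \<le> 1 / N" using N by (intro divide_right_mono) auto
      then show "g (jump x i z) - g (jump y i w) \<le> D - of_bool (x $ i \<noteq> y $ i) / N + 1 / N"
        using jd[of z w] by linarith
    qed (use r m_def in auto)
    then show "(\<Sum>z\<in>UNIV. (g (jump x i z) - g x) * r x z) - (\<Sum>z\<in>UNIV. (g (jump y i z) - g y) * r y z)
      \<le> m * (D - of_bool (x $ i \<noteq> y $ i) / N - \<delta>)
      + (R - m) * (D - of_bool (x $ i \<noteq> y $ i) / N + 1 / N - \<delta>)"
      by (simp add: jump_self \<delta>_def)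
  qed
  \<comment> \<open>The rates \<open>m\<close> and \<open>R - m\<close> recombine to
    \<open>R\<close> in front of the slack and of the removed disagreement; only the cost of
    splitting keeps \<open>R - m\<close>.\<close>
  also have "\<dots> = (\<Sum>i\<in>UNIV. R * (D - \<delta>) + (R - m) / N - R * (of_bool (x $ i \<noteq> y $ i) / N))"
    by (intro sum.cong) (auto simp: algebra_simps diff_divide_distrib)
  also have "\<dots> = N * (R * (D - \<delta>) + (R - m) / N) - R * (\<Sum>i\<in>UNIV. of_bool (x $ i \<noteq> y $ i) / N)"
    by (simp add: sum_subtractf N_def sum_distrib_left)
  also have "(\<Sum>i\<in>UNIV. of_bool (x $ i \<noteq> y $ i) / N) = D"
    by (simp add: D_def config_dist_def N_def flip: sum_divide_distrib)
  finally show ?thesis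
    using N by (simp add: N_def D_def \<delta>_def m_def distrib_left mult.assoc)
qed

lemma particle_system_ricci_ge:
  fixes f :: "real \<Rightarrow> real" and M :: "('e::finite) ^ 'n \<Rightarrow> 'w measure"
  assumes T: "0 \<le> T" and f: "\<And>u. u \<in> {0..1} \<Longrightarrow> 0 \<le> f u"
    and M: "markov_process M X" and gen: "has_generator M X (particle_generator T f)"
    and c: "\<And>x y :: 'e ^ 'n.
      (\<Sum>z\<in>UNIV. max 0 (f (empirical x z) - f (empirical y z))) \<le> c * config_dist x y"
  shows "ereal (T - c + (INF \<mu>::'e pmf. \<Sum>x\<in>UNIV. f (pmf \<mu> x))) \<le> coarse_ricci M X config_dist"
proof (rule coarse_ricci_ge[OF M gen])
  fix x y :: "'e ^ 'n" assume "x \<noteq> y"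
  define r where "r = (\<lambda>(x :: 'e ^ 'n) z. T / real CARD('e) + f (empirical x z))"
  define m where "m = (\<Sum>z\<in>UNIV. min (r x z) (r y z))"
  define R where "R = max (sum (r x) UNIV) (sum (r y) UNIV)"
  define I where "I = (INF \<mu>::'e pmf. \<Sum>x\<in>UNIV. f (pmf \<mu> x))"
  have r: "0 \<le> r x z" for x z
    using T f[of "empirical x z"] by (simp add: r_def empirical_nonneg empirical_le_1)
  have D: "0 \<le> config_dist x y" by (simp add: config_dist_def sum_nonneg)
  \<comment> \<open>Nonnegativity of \<open>f\<close> bounds the sums below, so the real infimum is
    a genuine lower bound.\<close>
  have "I \<le> (\<Sum>z\<in>UNIV. f (pmf (map_pmf (($) x) (pmf_of_set UNIV)) z))"
    unfolding I_def
    by (rule cINF_lower) (auto intro!: bdd_belowI[of _ 0] sum_nonneg f simp: pmf_le_1)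
  then have "T + I \<le> sum (r x) UNIV"
    by (simp add: empirical_pmf r_def sum.distrib)
  then have R: "(T + I) * config_dist x y \<le> R * config_dist x y"
    using D by (intro mult_right_mono) (auto simp: R_def)
  have excess: "sum (r x) UNIV - (\<Sum>z\<in>UNIV. min (r x z) (r y z)) \<le> c * config_dist x y" for x y
  proof -
    have "r x z - min (r x z) (r y z) = max 0 (f (empirical x z) - f (empirical y z))" for z
      by (auto simp: r_def)
    then show ?thesis using c[of x y] by (simp flip: sum_subtractf)
  qed
  \<comment> \<open>The maximum \<open>R\<close> is attained at \<open>x\<close> or at
    \<open>y\<close> and \<open>m\<close> is symmetric, so \<open>excess\<close> is used in both
    orders.\<close>
  have Rm: "R - m \<le> c * config_dist x y"
    using excess[of x y] excess[of y x]
    by (auto simp: R_def m_def max_def config_dist_commute[of y x] min.commute[of "r y _"])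
  show "\<exists>K. \<forall>g. (\<forall>u v. g u - g v \<le> config_dist u v) \<longrightarrow>
      particle_generator T f g x - particle_generator T f g y
        \<le> K * (config_dist x y - (g x - g y))
          - (T - c + (INF \<mu>::'e pmf. \<Sum>x\<in>UNIV. f (pmf \<mu> x))) * config_dist x y"
  proof (intro exI allI impI)
    fix g :: "'e ^ 'n \<Rightarrow> real" assume g: "\<forall>u v. g u - g v \<le> config_dist u v"
    have "particle_generator T f g x - particle_generator T f g y
      \<le> real CARD('n) * R * (config_dist x y - (g x - g y)) - R * config_dist x y + (R - m)"
      using particle_generator_contraction[of T f g x y] r g by (simp add: r_def R_def m_def)
    then show "particle_generator T f g x - particle_generator T f g y
        \<le> real CARD('n) * R * (config_dist x y - (g x - g y))
          - (T - c + (INF \<mu>::'e pmf. \<Sum>x\<in>UNIV. f (pmf \<mu> x))) * config_dist x y"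
      using R Rm unfolding I_def[symmetric] by (simp add: algebra_simps)
  qed
qed (simp_all add: config_dist_self config_dist_pos config_dist_triangle config_dist_commute)

section \<open>From the Lipschitz norm to the two curvature bounds\<close>

lemma lip_norm_bound:
  assumes "C-lipschitz_on {0..1} f" and "u \<in> {0..1}" "v \<in> {0..1}"
  shows "\<bar>f u - f v\<bar> \<le> lip_norm f * \<bar>u - v\<bar>"
proof (cases "u = v")
  case False
  let ?S = "{(u, v). u \<in> {0..1::real} \<and> v \<in> {0..1} \<and> u \<noteq> v}"
  have "\<bar>f u - f v\<bar> / \<bar>u - v\<bar> \<le> C" if "u \<in> {0..1}" "v \<in> {0..1}" "u \<noteq> v" for u v
    using lipschitz_onD[OF assms(1) that(1,2)] that(3) by (simp add: dist_real_def field_simps)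
  \<comment> \<open>Without an upper bound on the quotients, the real supremum need not dominate
    them.\<close>
  then have "bdd_above ((\<lambda>(u, v). \<bar>f u - f v\<bar> / \<bar>u - v\<bar>) ` ?S)"
    by (intro bdd_aboveI[of _ C]) auto
  then have "(\<lambda>(u, v). \<bar>f u - f v\<bar> / \<bar>u - v\<bar>) (u, v) \<le> lip_norm f"
    unfolding lip_norm_def by (rule cSUP_upper[rotated]) (use assms False in auto)
  then show ?thesis using False by (simp add: field_simps)
qed simp

text \<open>
  For monotone \<open>f\<close> only one of \<open>a\<close> and \<open>b\<close> is needed, which is where the factor 2 is saved.
\<close>

lemma sum_excess_le:
  fixes x y :: "('e::finite) ^ 'n"
  assumes f: "\<And>u v. u \<in> {0..1} \<Longrightarrow> v \<in> {0..1} \<Longrightarrow>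
    max 0 (f u - f v) \<le> a * max 0 (u - v) + b * max 0 (v - u)" and ab: "0 \<le> a" "0 \<le> b"
  shows "(\<Sum>z\<in>UNIV. max 0 (f (empirical x z) - f (empirical y z))) \<le> (a + b) * config_dist x y"
proof -
  have "(\<Sum>z\<in>UNIV. max 0 (f (empirical x z) - f (empirical y z)))
      \<le> (\<Sum>z\<in>UNIV. a * max 0 (empirical x z - empirical y z) + b * max 0 (empirical y z - empirical x z))"
    by (intro sum_mono f) (simp_all add: empirical_nonneg empirical_le_1)
  also have "\<dots> = a * (\<Sum>z\<in>UNIV. max 0 (empirical x z - empirical y z))
      + b * (\<Sum>z\<in>UNIV. max 0 (empirical y z - empirical x z))"
    by (simp add: sum.distrib sum_distrib_left)
  also have "\<dots> \<le> a * config_dist x y + b * config_dist y x"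
    using ab by (intro add_mono mult_left_mono empirical_excess_le)
  finally show ?thesis by (simp add: config_dist_commute[of y x] distrib_right)
qed

theorem proposition3p1:
  fixes T :: real and f :: "real \<Rightarrow> real"
    and M :: "('e::finite) ^ 'n \<Rightarrow> 'w measure"
    and X :: "real \<Rightarrow> 'w \<Rightarrow> 'e ^ 'n"
  assumes "CARD('e) \<ge> 3" and "CARD('n) \<ge> 2" and "T > 0"
    and "\<And>u. u \<in> {0..1} \<Longrightarrow> f u \<ge> 0"
    and "\<exists>C. C-lipschitz_on {0..1} f"
    and "markov_process M X"
    and "has_generator M X (particle_generator T f)"
  shows "coarse_ricci M X config_dist
           \<ge> ereal (T - 2 * lip_norm f + (INF \<mu>::'e pmf. \<Sum>x\<in>UNIV. f (pmf \<mu> x)))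
       \<and> (mono_on {0..1} f \<or> antimono_on {0..1} f \<longrightarrow>
           coarse_ricci M X config_dist
             \<ge> ereal (T - lip_norm f + (INF \<mu>::'e pmf. \<Sum>x\<in>UNIV. f (pmf \<mu> x))))"
proof -
  let ?l = "lip_norm f"
  obtain C where C: "C-lipschitz_on {0..1} f" using assms(5) by blast
  note lip = lip_norm_bound[OF C]
  have l: "0 \<le> ?l" using lip[of 0 1] by simp
  have ge: "ereal (T - (a + b) + (INF \<mu>::'e pmf. \<Sum>x\<in>UNIV. f (pmf \<mu> x))) \<le> coarse_ricci M X config_dist"
    if "\<And>u v. u \<in> {0..1} \<Longrightarrow> v \<in> {0..1} \<Longrightarrow>
      max 0 (f u - f v) \<le> a * max 0 (u - v) + b * max 0 (v - u)" "0 \<le> a" "0 \<le> b" for a b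
    using assms(3,4,6,7) sum_excess_le[OF that] by (intro particle_system_ricci_ge) auto
  have split: "max 0 (f u - f v) \<le> ?l * max 0 (u - v) + ?l * max 0 (v - u)"
    if "u \<in> {0..1}" "v \<in> {0..1}" for u v
    using lip[OF that] l by (auto simp: max_def abs_if)
  show ?thesis
  proof (intro conjI impI)
    show "ereal (T - 2 * ?l + (INF \<mu>::'e pmf. \<Sum>x\<in>UNIV. f (pmf \<mu> x))) \<le> coarse_ricci M X config_dist"
      using ge[OF split l l] by simp
    assume "mono_on {0..1} f \<or> antimono_on {0..1} f"
    then show "ereal (T - ?l + (INF \<mu>::'e pmf. \<Sum>x\<in>UNIV. f (pmf \<mu> x))) \<le> coarse_ricci M X config_dist"
    proof
      assume mono: "mono_on {0..1} f"
      \<comment> \<open>For increasing \<open>f\<close> the left side vanishes when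
        \<open>u \<le> v\<close>, so only the positive part of \<open>u - v\<close> is charged; the
        decreasing case mirrors this.\<close>
      have "max 0 (f u - f v) \<le> ?l * max 0 (u - v) + 0 * max 0 (v - u)"
        if "u \<in> {0..1}" "v \<in> {0..1}" for u v
        using split[OF that] mono_onD[OF mono, of u v] that by (cases "u \<le> v") auto
      from ge[OF this l order_refl] show ?thesis by simp
    next
      assume anti: "antimono_on {0..1} f"
      have "max 0 (f u - f v) \<le> 0 * max 0 (u - v) + ?l * max 0 (v - u)"
        if "u \<in> {0..1}" "v \<in> {0..1}" for u v
        using split[OF that] monotone_onD[OF anti, of v u] that by (cases "v \<le> u") auto
      from ge[OF this order_refl l] show ?thesis by simp
    qed
  qed
qed

end
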